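(* Let $K$ be a subfield of $\mathbb{R}$, let $n\geq 2$ be an integer and let $A\in\mathcal{M}_n(K)$. Then $\det(AX+XA)\leq 0$ for every $X\in\mathcal{M}_n(K)$ if and only if $\mathrm{rank}(A)<n/2$.
   Context: $\mathcal{M}_n(K)$ denotes the set of $n\times n$ matrices with entries in $K$. The order on $K$ is the one induced from $\mathbb{R}$. *)

theory Defs
  imports
    Complex_Main
    "HOL-Algebra.Subrings"
    "Jordan_Normal_Form.DL_Rank"
begin

definition mats_over :: "'a set \<Rightarrow> nat \<Rightarrow> 'a mat set" where
  "mats_over K n = {A \<in> carrier_mat n n. elements_mat A \<subseteq> K}"

lemma mats_over_iff:
  "A \<in> mats_over K n \<longleftrightarrow> A \<in> carrier_mat n n \<and> (\<forall>i<n. \<forall>j<n. A $$ (i, j) \<in> K)"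
  unfolding mats_over_def elements_mat_def by fastforce

lemma subfield_class_ring_iff:
  fixes K :: "'a::field set"
  shows "subfield K class_ring \<longleftrightarrow>
    1 \<in> K \<and> (\<forall>x\<in>K. - x \<in> K) \<and> (\<forall>x\<in>K. inverse x \<in> K) \<and>
    (\<forall>x\<in>K. \<forall>y\<in>K. x + y \<in> K) \<and> (\<forall>x\<in>K. \<forall>y\<in>K. x * y \<in> K)"
  (is "?L \<longleftrightarrow> ?R")
proof
  assume ?L
  then interpret subfield K "class_ring :: 'a ring" .
  have r: "subring K (class_ring :: 'a ring)" by unfold_locales
  have one: "1 \<in> K" using subringE(3)[OF r] by simp
  have zero: "0 \<in> K" using subringE(2)[OF r] by simp
  have neg: "- x \<in> K" if "x \<in> K" for x
    using subringE(5)[OF r that] by (simp add: class_ring_simps)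
  have mult: "x * y \<in> K" if "x \<in> K" "y \<in> K" for x y
    using subringE(6)[OF r that] by simp
  have add: "x + y \<in> K" if "x \<in> K" "y \<in> K" for x y
    using subringE(7)[OF r that] by simp
  have inv: "inverse x \<in> K" if "x \<in> K" for x
  proof (cases "x = 0")
    case True
    then show ?thesis using zero by simp
  next
    case False
    with that have "x \<in> Units ((class_ring :: 'a ring)\<lparr>carrier := K\<rparr>)"
      using subfield_Units by simp
    then obtain y where "y \<in> K" "x * y = 1"
      unfolding Units_def by auto
    then show ?thesis by (metis inverse_unique)
  qed
  show ?R by (intro conjI ballI one neg inv add mult)
next
  assume R: ?R
  have ring: "ring (class_ring :: 'a ring)" by (rule class_ring.ring_axioms)
  have r: "subring K (class_ring :: 'a ring)"
    by (rule ring.subringI[OF ring]) (use R in \<open>simp_all add: class_ring_simps\<close>)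
  have c: "subcring K (class_ring :: 'a ring)"
    by (rule ring.subcringI[OF ring r]) (simp add: mult.commute)
  have "Units ((class_ring :: 'a ring)\<lparr>carrier := K\<rparr>) = K - {0}"
  proof (intro equalityI subsetI)
    fix x assume "x \<in> Units ((class_ring :: 'a ring)\<lparr>carrier := K\<rparr>)"
    then show "x \<in> K - {0}" unfolding Units_def by auto
  next
    fix x assume "x \<in> K - {0}"
    then have x: "x \<in> K" "x \<noteq> 0" by simp_all
    with R have "inverse x \<in> K" by simp
    with x show "x \<in> Units ((class_ring :: 'a ring)\<lparr>carrier := K\<rparr>)"
      unfolding Units_def by (simp add: bexI[of _ "inverse x"])
  qed
  then show ?L by (intro ring.subfieldI[OF ring c]) simp
qed

end

theory Submission
  imports Defs
begin

text \<open>Factor \<open>A = B C\<close> through dimension \<open>r = rank A\<close>.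
  If \<open>2 r < n\<close>, then \<open>C\<close> and \<open>C X\<close> have a common nonzero kernel vector, which
  \<open>A X + X A\<close> annihilates; so the determinant always vanishes.

  If \<open>2 r \<ge> n\<close>, take \<open>X\<close> to be the adjoint \<open>A\<^sup>*\<close> of \<open>A\<close> with respect to a suitable inner
  product: \<open>A A\<^sup>* + A\<^sup>* A\<close> is positive semidefinite, and it is definite as soon as \<open>ker A\<close> meets
  the orthogonal complement of \<open>im A\<close> trivially. Since \<open>dim (ker A) \<le> n / 2\<close>, some inner
  product achieves this; the inverse of its Gram matrix is reached from the identity by adding terms
  \<open>v v\<^sup>T\<close>, each of which shrinks that intersection. This gives a real \<open>X\<close> with positive
  determinant, and rational matrices are dense in the real ones.\<close>

section \<open>Block matrices, kernels by dimension count, and rank factorization\<close>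

definition append_cols :: "'a :: zero mat \<Rightarrow> 'a mat \<Rightarrow> 'a mat" where
  "append_cols E F = (E\<^sup>T @\<^sub>r F\<^sup>T)\<^sup>T"

lemma append_cols_carrier:
  assumes "E \<in> carrier_mat n p" "F \<in> carrier_mat n q"
  shows "append_cols E F \<in> carrier_mat n (p + q)"
  using assms unfolding append_cols_def by simp

lemma append_cols_mult_vec:
  fixes E F :: "'a :: comm_semiring_1 mat"
  assumes E: "E \<in> carrier_mat n p" and F: "F \<in> carrier_mat n q"
    and x: "x \<in> carrier_vec p" and y: "y \<in> carrier_vec q"
  shows "append_cols E F *\<^sub>v (x @\<^sub>v y) = E *\<^sub>v x + F *\<^sub>v y"
proof (rule eq_vecI)
  have c: "append_cols E F \<in> carrier_mat n (p + q)"
    using E F by (rule append_cols_carrier)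
  fix i assume "i < dim_vec (E *\<^sub>v x + F *\<^sub>v y)"
  then have i: "i < n" using F by simp
  have "row (append_cols E F) i = row E i @\<^sub>v row F i"
    by (rule eq_vecI) (use c E F i in \<open>auto simp: append_cols_def append_rows_def\<close>)
  then show "(append_cols E F *\<^sub>v (x @\<^sub>v y)) $ i = (E *\<^sub>v x + F *\<^sub>v y) $ i"
    using c E F i x y
      scalar_prod_append[of "row E i" p "row F i" q x y]
    by (auto simp: index_mult_mat_vec)
qed (use carrier_matD(1)[OF append_cols_carrier[OF E F]] F in auto)

lemma mult_mat_unit_vec:
  fixes A :: "'a :: semiring_1 mat"
  assumes "A \<in> carrier_mat n nc" "j < nc"
  shows "A *\<^sub>v unit_vec nc j = col A j"
  by (rule eq_vecI) (use assms in auto)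

lemma mult_mat_zero_vec:
  fixes A :: "'a :: semiring_0 mat"
  assumes "A \<in> carrier_mat n nc"
  shows "A *\<^sub>v 0\<^sub>v nc = 0\<^sub>v n"
  by (rule eq_vecI) (use assms in auto)

lemma smult_vec_zero:
  fixes v :: "'a :: semiring_0 vec"
  assumes "v \<in> carrier_vec n"
  shows "0 \<cdot>\<^sub>v v = 0\<^sub>v n"
  by (rule eq_vecI) (use assms in auto)

lemma smult_zero_vec: "c \<cdot>\<^sub>v 0\<^sub>v n = (0\<^sub>v n :: 'a :: mult_zero vec)"
  by (rule eq_vecI) auto

text \<open>Padding with zero rows makes the matrix square with a zero row, hence with determinant
  0. The kernel vector of the padded matrix is then a kernel vector of \<open>M\<close>.\<close>

lemma wide_mat_kernel:
  fixes M :: "'a :: field mat"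
  assumes M: "M \<in> carrier_mat m p" and "m < p"
  obtains x where "x \<in> carrier_vec p" "x \<noteq> 0\<^sub>v p" "M *\<^sub>v x = 0\<^sub>v m"
proof -
  define M' where "M' = M @\<^sub>r 0\<^sub>m (p - m) p"
  have M': "M' \<in> carrier_mat p p"
    unfolding M'_def using carrier_append_rows[OF M zero_carrier_mat[of "p - m" p]] \<open>m < p\<close> by simp
  have "M' $$ (m, j) = 0" if "j < p" for j
    using M \<open>m < p\<close> that unfolding M'_def append_rows_def by simp
  then have "row M' m = 0\<^sub>v p"
    using M' \<open>m < p\<close> by (intro eq_vecI) auto
  then have "M' $$ (m, j) = 0" if "j < p" for j
    using M' that \<open>m < p\<close> by (metis carrier_matD index_row(1) index_zero_vec(1))
  then have "det M' = 0"
    using laplace_expansion_row[OF M' \<open>m < p\<close>] by simp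
  then obtain x where x: "x \<in> carrier_vec p" "x \<noteq> 0\<^sub>v p" "M' *\<^sub>v x = 0\<^sub>v p"
    using det_0_iff_vec_prod_zero[OF M'] by blast
  have "M *\<^sub>v x @\<^sub>v 0\<^sub>m (p - m) p *\<^sub>v x = 0\<^sub>v p"
    using mat_mult_append[OF M zero_carrier_mat x(1)] x(3) unfolding M'_def by metis
  also have "\<dots> = 0\<^sub>v m @\<^sub>v 0\<^sub>v (p - m)"
    using \<open>m < p\<close> by (intro eq_vecI) auto
  finally have "M *\<^sub>v x = 0\<^sub>v m"
    by (subst (asm) append_vec_eq[of _ m]) (use M x in auto)
  with x show ?thesis using that by blast
qed

text \<open>Dimension count for two families of columns: a kernel vector of the joined matrix, cut
  at position \<open>p\<close>, is a nontrivial dependency between them.\<close>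

lemma append_cols_kernel:
  fixes E F :: "'a :: field mat"
  assumes E: "E \<in> carrier_mat n p" and F: "F \<in> carrier_mat n q" and "n < p + q"
  obtains x y where "x \<in> carrier_vec p" "y \<in> carrier_vec q" "E *\<^sub>v x + F *\<^sub>v y = 0\<^sub>v n"
    "x \<noteq> 0\<^sub>v p \<or> y \<noteq> 0\<^sub>v q"
proof -
  obtain z where z: "z \<in> carrier_vec (p + q)" "z \<noteq> 0\<^sub>v (p + q)"
      "append_cols E F *\<^sub>v z = 0\<^sub>v n"
    using wide_mat_kernel[OF append_cols_carrier[OF E F] \<open>n < p + q\<close>] .
  have split: "z = vec_first z p @\<^sub>v vec_last z q"
    using z(1) by simp
  have "0\<^sub>v p @\<^sub>v 0\<^sub>v q = (0\<^sub>v (p + q) :: 'a vec)" by (intro eq_vecI) auto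
  with split z(2) have "vec_first z p \<noteq> 0\<^sub>v p \<or> vec_last z q \<noteq> 0\<^sub>v q" by metis
  moreover have "E *\<^sub>v vec_first z p + F *\<^sub>v vec_last z q = 0\<^sub>v n"
    using append_cols_mult_vec[OF E F, of "vec_first z p" "vec_last z q"] z(3) split by simp
  ultimately show ?thesis using that by (metis vec_first_carrier vec_last_carrier)
qed

text \<open>The columns of \<open>B\<close> are a maximal independent set of columns of \<open>A\<close>, and \<open>S\<close>
  selects them.\<close>

lemma (in vec_space) rank_factorization:
  assumes A: "A \<in> carrier_mat n nc"
  obtains B C S where "B \<in> carrier_mat n (rank A)" "C \<in> carrier_mat (rank A) nc"
    "S \<in> carrier_mat nc (rank A)" "A = B * C" "B = A * S" "C * S = 1\<^sub>m (rank A)"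
    "\<And>x. x \<in> carrier_vec (rank A) \<Longrightarrow> B *\<^sub>v x = 0\<^sub>v n \<Longrightarrow> x = 0\<^sub>v (rank A)"
proof -
  let ?P = "\<lambda>T. T \<subseteq> set (cols A) \<and> lin_indpt T"
  have cA: "set (cols A) \<subseteq> carrier_vec n" using cols_dim A by blast
  have "?P {}" using finite_lin_indpt2 by auto
  then obtain U where maxU: "maximal U ?P"
    using maximal_exists_superset[of "set (cols A)" ?P "{}"] by auto
  then have U: "U \<subseteq> set (cols A)" "lin_indpt U" unfolding maximal_def by auto
  have finU: "finite U" using U(1) finite_subset by blast
  obtain us where us: "set us = U" "distinct us"
    using finite_distinct_list[OF finU] by blast
  define r where "r = rank A"
  have r: "r = length us"
    using rank_card_indpt[OF A maxU] us distinct_card unfolding r_def by metis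
  define B where "B = mat_of_cols n us"
  have B: "B \<in> carrier_mat n r" unfolding B_def r by simp
  have colsB: "cols B = us"
    unfolding B_def using U us cA by (intro cols_mat_of_cols) auto
  have injB: "x = 0\<^sub>v r" if "x \<in> carrier_vec r" "B *\<^sub>v x = 0\<^sub>v n" for x
    using lin_depI[OF B that(1) _ that(2)] U us colsB by auto
  have UV: "U \<subseteq> carrier_vec n" using U cA by blast
  have "\<exists>c \<in> carrier_vec r. B *\<^sub>v c = a" if a: "a \<in> set (cols A)" for a
  proof -
    have "a \<in> span U"
    proof (cases "a \<in> U")
      case True
      then show ?thesis using in_own_span[OF UV] by blast
    next
      case False
      show ?thesis
      proof (rule ccontr)
        assume "a \<notin> span U"
        then have "lin_indpt (U \<union> {a})"
          using lin_dep_iff_in_span[OF UV U(2), of a] False a cA by auto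
        then show False
          using maxU a U(1) False unfolding maximal_def by blast
      qed
    qed
    then obtain f where "a = lincomb f U"
      using finite_in_span[OF finU UV] by blast
    \<comment> \<open>\<open>lincomb\<close> attaches coefficients to vectors, not to positions.
      Since \<open>us\<close> is distinct, reading \<open>f\<close> along the columns of
      \<open>B\<close> gives the matching coordinate vector.\<close>
    then have "B *\<^sub>v vec r (\<lambda>i. f (col B i)) = a"
      using mat_mult_eq_lincomb[OF B] colsB us by simp
    then show ?thesis by (intro bexI[of _ "vec r (\<lambda>i. f (col B i))"]) auto
  qed
  then have "\<forall>j<nc. \<exists>c. c \<in> carrier_vec r \<and> B *\<^sub>v c = col A j"
    using A by (metis carrier_matD(2) cols_length cols_nth nth_mem)
  then obtain c where c: "\<And>j. j < nc \<Longrightarrow> c j \<in> carrier_vec r \<and> B *\<^sub>v c j = col A j"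
    by metis
  define C where "C = mat_of_cols r (map c [0..<nc])"
  have C: "C \<in> carrier_mat r nc" unfolding C_def by (simp add: carrier_matI)
  have colC: "col C j = c j" if "j < nc" for j
    using that c unfolding C_def by simp
  have BC: "A = B * C"
  proof (rule mat_col_eqI)
    fix j assume "j < dim_col (B * C)"
    then have j: "j < nc" using C by simp
    show "col A j = col (B * C) j"
      unfolding col_mult2[OF B C j] colC[OF j] using c[OF j] by simp
  qed (use A B C in auto)
  have "\<exists>j<nc. us ! i = col A j" if "i < r" for i
  proof -
    have "us ! i \<in> set (cols A)" using that r us U by auto
    then show ?thesis using A by (metis in_set_conv_nth carrier_matD(2) cols_length cols_nth)
  qed
  then obtain s where s: "\<And>i. i < r \<Longrightarrow> s i < nc \<and> us ! i = col A (s i)" by metis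
  define S where "S = mat_of_cols nc (map (\<lambda>i. unit_vec nc (s i) :: 'a vec) [0..<r])"
  have S: "S \<in> carrier_mat nc r" unfolding S_def by (simp add: carrier_matI)
  have colS: "col S i = unit_vec nc (s i)" if "i < r" for i
    using that unfolding S_def by simp
  have colB: "col B i = us ! i" if "i < r" for i
    using that r colsB B by (metis carrier_matD(2) cols_nth)
  have BS: "B = A * S"
  proof (rule mat_col_eqI)
    fix i assume "i < dim_col (A * S)"
    then have i: "i < r" using S by simp
    show "col B i = col (A * S) i"
      unfolding col_mult2[OF A S i] colS[OF i] colB[OF i] using s[OF i] mult_mat_unit_vec[OF A] by simp
  qed (use A B S in auto)
  have "C * S = 1\<^sub>m r"
  proof (rule mat_col_eqI)
    fix i assume "i < dim_col (1\<^sub>m r :: 'a mat)"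
    then have i: "i < r" by simp
    \<comment> \<open>\<open>B (C S) = A S = B\<close>, so \<open>B\<close> kills this difference,
      and \<open>injB\<close> forces it to be zero.\<close>
    let ?d = "col (C * S) i - unit_vec r i"
    have "B *\<^sub>v ?d = B *\<^sub>v col (C * S) i - B *\<^sub>v unit_vec r i"
      by (rule mult_minus_distrib_mat_vec[OF B]) (use C S i in auto)
    also have "\<dots> = col (B * (C * S)) i - col B i"
      using col_mult2[OF B mult_carrier_mat[OF C S] i] mult_mat_unit_vec[OF B i] by simp
    also have "B * (C * S) = B"
      using assoc_mult_mat[OF B C S] unfolding BC[symmetric] BS[symmetric] by simp
    finally have "B *\<^sub>v ?d = 0\<^sub>v n" using B i by simp
    then have "?d = 0\<^sub>v r" using C S i by (intro injB) auto
    then have "col (C * S) i $ k - unit_vec r i $ k = 0" if "k < r" for k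
      using C S that by (metis index_minus_vec(1) index_unit_vec(3) index_zero_vec(1))
    then show "col (C * S) i = col (1\<^sub>m r) i"
      using C S i by (intro eq_vecI) auto
  qed (use C S in auto)
  then show ?thesis using that[OF _ _ _ BC BS _] B C S injB unfolding r_def by blast
qed

section \<open>Positive definite real matrices and the adjoint witness\<close>

lemma scalar_prod_self_nonneg: "0 \<le> (v :: real vec) \<bullet> v"
  unfolding scalar_prod_def by (intro sum_nonneg) simp

lemma scalar_prod_self_eq_0_iff:
  fixes v :: "real vec"
  assumes "v \<in> carrier_vec n"
  shows "v \<bullet> v = 0 \<longleftrightarrow> v = 0\<^sub>v n"
  using conjugate_square_eq_0_vec[OF assms] assms by simp

lemma scalar_prod_transpose_mult:
  fixes A :: "'a :: comm_semiring_0 mat"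
  assumes "A \<in> carrier_mat m k" "x \<in> carrier_vec m" "y \<in> carrier_vec k"
  shows "x \<bullet> (A *\<^sub>v y) = (A\<^sup>T *\<^sub>v x) \<bullet> y"
  using transpose_vec_mult_scalar[OF assms(1,3,2)] assms
  by (metis comm_scalar_prod mult_mat_vec_carrier transpose_carrier_mat)

text \<open>Only the quadratic form is constrained. Where symmetry matters it is carried separately
  as \<open>H\<^sup>T = H\<close>, so no symmetry has to be proved for inverses or for the matrix
  \<open>M\<close> built from the witness.\<close>

definition pos_def :: "nat \<Rightarrow> real mat \<Rightarrow> bool" where
  "pos_def n M \<longleftrightarrow> M \<in> carrier_mat n n \<and>
    (\<forall>x \<in> carrier_vec n. x \<noteq> 0\<^sub>v n \<longrightarrow> 0 < x \<bullet> (M *\<^sub>v x))"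

lemma smult_mat_mult_vec:
  fixes M :: "'a :: comm_ring_1 mat"
  assumes "M \<in> carrier_mat n m" "x \<in> carrier_vec m"
  shows "(c \<cdot>\<^sub>m M) *\<^sub>v x = c \<cdot>\<^sub>v (M *\<^sub>v x)"
  by (rule eq_vecI) (use assms in \<open>auto simp: scalar_prod_def sum_distrib_left ac_simps\<close>)

lemma pos_def_one: "pos_def n (1\<^sub>m n)"
  using scalar_prod_self_nonneg scalar_prod_self_eq_0_iff
  unfolding pos_def_def by (force simp: less_le)

lemma pos_def_nonneg:
  assumes "pos_def n M" "x \<in> carrier_vec n"
  shows "0 \<le> x \<bullet> (M *\<^sub>v x)"
  using assms unfolding pos_def_def by (cases "x = 0\<^sub>v n") (auto simp: less_imp_le)

lemma pos_def_eq_0: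
  assumes "pos_def n M" "x \<in> carrier_vec n" "x \<bullet> (M *\<^sub>v x) = 0"
  shows "x = 0\<^sub>v n"
  using assms unfolding pos_def_def by force

lemma pos_def_det_nonzero:
  assumes "pos_def n M"
  shows "det M \<noteq> 0"
proof
  assume "det M = 0"
  moreover have M: "M \<in> carrier_mat n n" using assms unfolding pos_def_def by blast
  ultimately obtain x where "x \<in> carrier_vec n" "x \<noteq> 0\<^sub>v n" "M *\<^sub>v x = 0\<^sub>v n"
    using det_0_iff_vec_prod_zero[OF M] by blast
  then show False using assms unfolding pos_def_def by force
qed

text \<open>By the Leibniz formula the determinant is a polynomial in the entries. The filter is
  arbitrary because the lemma serves both for continuity along a segment and for limits of
  sequences.\<close>

lemma tendsto_det:
  fixes M :: "'b \<Rightarrow> real mat"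
  assumes "\<And>t. M t \<in> carrier_mat n n" "L \<in> carrier_mat n n"
    and "\<And>i j. i < n \<Longrightarrow> j < n \<Longrightarrow> ((\<lambda>t. M t $$ (i, j)) \<longlongrightarrow> L $$ (i, j)) F"
  shows "((\<lambda>t. det (M t)) \<longlongrightarrow> det L) F"
  unfolding det_def'[OF assms(1)] det_def'[OF assms(2)]
  by (intro tendsto_intros assms(3)) (auto simp: permutes_in_image)

text \<open>Every matrix on the segment from the identity to \<open>M\<close> is
  nonsingular, so the determinant does not change sign along it.\<close>

lemma pos_def_det_pos:
  assumes "pos_def n M"
  shows "0 < det M"
proof (rule ccontr)
  assume "\<not> 0 < det M"
  have M: "M \<in> carrier_mat n n" using assms unfolding pos_def_def by blast
  define P where "P t = (1 - t) \<cdot>\<^sub>m 1\<^sub>m n + t \<cdot>\<^sub>m M" for t :: real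
  have P: "P t \<in> carrier_mat n n" for t unfolding P_def using M by simp
  have "P 0 = 1\<^sub>m n" "P 1 = M" unfolding P_def using M by (auto intro!: eq_matI)
  then have ends: "det (P 0) = 1" "det (P 1) \<le> 0" using \<open>\<not> 0 < det M\<close> by auto
  have "isCont (\<lambda>t. det (P t)) s" for s
    unfolding isCont_def
    by (rule tendsto_det[OF P P]) (use M in \<open>auto simp: P_def intro!: tendsto_intros\<close>)
  then obtain t where t: "0 \<le> t" "t \<le> 1" "det (P t) = 0"
    using IVT2[of "\<lambda>t. det (P t)" 1 0 0] ends by auto
  have "pos_def n (P t)"
    unfolding pos_def_def
  proof (intro conjI P ballI impI)
    fix x :: "real vec" assume x: "x \<in> carrier_vec n" "x \<noteq> 0\<^sub>v n"
    have "P t *\<^sub>v x = (1 - t) \<cdot>\<^sub>v x + t \<cdot>\<^sub>v (M *\<^sub>v x)"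
      unfolding P_def using M x(1)
      by (subst add_mult_distrib_mat_vec[of _ n n]) (auto simp: smult_mat_mult_vec)
    then have "x \<bullet> (P t *\<^sub>v x) = (1 - t) * (x \<bullet> x) + t * (x \<bullet> (M *\<^sub>v x))"
      using M x(1) by (simp add: scalar_prod_add_distrib[of _ n])
    moreover have "0 < x \<bullet> x" "0 < x \<bullet> (M *\<^sub>v x)"
      using x assms scalar_prod_self_nonneg[of x] scalar_prod_self_eq_0_iff[OF x(1)]
      unfolding pos_def_def by auto
    ultimately show "0 < x \<bullet> (P t *\<^sub>v x)"
      using t(1,2) by (cases "t = 0") (auto intro: add_nonneg_pos)
  qed
  then show False using pos_def_det_nonzero t(3) by blast
qed

text \<open>Substituting \<open>y = G x\<close> turns the form of \<open>G\<close> at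
  \<open>x\<close> into the form of \<open>H\<close> at \<open>y\<close>.\<close>

lemma pos_def_inverse:
  assumes "pos_def n H"
  obtains G where "pos_def n G" "H * G = 1\<^sub>m n" "G * H = 1\<^sub>m n"
proof -
  have H: "H \<in> carrier_mat n n" using assms unfolding pos_def_def by blast
  obtain G where G: "G \<in> carrier_mat n n" "H * G = 1\<^sub>m n" "G * H = 1\<^sub>m n"
    \<comment> \<open>\<open>undefined\<close> fills the record extension slot of
      \<open>ring_mat\<close>, whose value is irrelevant.\<close>
    using det_non_zero_imp_unit[OF H pos_def_det_nonzero[OF assms], of undefined]
    unfolding Units_def ring_mat_def by auto
  have "pos_def n G"
    unfolding pos_def_def
  proof (intro conjI G ballI impI)
    fix x :: "real vec" assume x: "x \<in> carrier_vec n" "x \<noteq> 0\<^sub>v n"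
    have Gx: "G *\<^sub>v x \<in> carrier_vec n" using G x by simp
    have HGx: "H *\<^sub>v (G *\<^sub>v x) = x"
      using assoc_mult_mat_vec[OF H G(1) x(1)] G x by simp
    then have "G *\<^sub>v x \<noteq> 0\<^sub>v n" using H x by force
    then have "0 < (G *\<^sub>v x) \<bullet> (H *\<^sub>v (G *\<^sub>v x))"
      using assms Gx unfolding pos_def_def by blast
    then show "0 < x \<bullet> (G *\<^sub>v x)"
      using comm_scalar_prod[OF x(1) Gx] HGx by simp
  qed
  with G show ?thesis using that by blast
qed

text \<open>The witness \<open>X = H A\<^sup>T H\<^sup>-\<^sup>1\<close> is the adjoint of \<open>A\<close> for the inner product with Gram matrix
  \<open>H\<^sup>-\<^sup>1\<close>; then \<open>(A X + X A) H\<close> is positive definite.\<close>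

lemma pos_def_conj_sum:
  assumes H: "pos_def n H" "H\<^sup>T = H" and A: "A \<in> carrier_mat n n"
    and inj: "\<And>u. u \<in> carrier_vec n \<Longrightarrow> A\<^sup>T *\<^sub>v u = 0\<^sub>v n \<Longrightarrow>
      A *\<^sub>v (H *\<^sub>v u) = 0\<^sub>v n \<Longrightarrow> u = 0\<^sub>v n"
  obtains X where "X \<in> carrier_mat n n" "0 < det (A * X + X * A)"
proof -
  have cH: "H \<in> carrier_mat n n" using H unfolding pos_def_def by blast
  obtain G where G: "pos_def n G" "H * G = 1\<^sub>m n" "G * H = 1\<^sub>m n"
    using pos_def_inverse[OF H(1)] .
  have cG: "G \<in> carrier_mat n n" using G unfolding pos_def_def by blast
  have cT: "A\<^sup>T \<in> carrier_mat n n" using A by simp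
  define X where "X = H * (A\<^sup>T * G)"
  \<comment> \<open>\<open>M\<close> is \<open>(A X + X A) H\<close> after cancelling
    \<open>G H = 1\<close>.\<close>
  define M where "M = A * (H * A\<^sup>T) + H * (A\<^sup>T * (G * (A * H)))"
  have X: "X \<in> carrier_mat n n" unfolding X_def using cH cT cG by auto
  have M: "M \<in> carrier_mat n n" unfolding M_def using cH cT cG A by auto
  note mc = mult_carrier_mat[of _ n n _ n] A cH cG cT
  have "A * X = A * (H * A\<^sup>T) * G"
    unfolding X_def by (simp add: mc assoc_mult_mat[of _ n n _ n _ n])
  moreover have "X * A = H * (A\<^sup>T * (G * (A * H))) * G"
    unfolding X_def by (simp add: mc assoc_mult_mat[of _ n n _ n _ n] G
      right_mult_one_mat[of _ n n])
  ultimately have fac: "A * X + X * A = M * G"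
    unfolding M_def by (subst add_mult_distrib_mat[of _ n n _ _ n]) (auto simp: mc)
  have "pos_def n M"
    unfolding pos_def_def
  proof (intro conjI M ballI impI)
    fix u :: "real vec" assume u: "u \<in> carrier_vec n" "u \<noteq> 0\<^sub>v n"
    \<comment> \<open>The form of \<open>M\<close> at \<open>u\<close> is the form of
      \<open>H\<close> at \<open>?a\<close> plus the form of \<open>G\<close> at \<open>?b\<close>.
      Both are nonnegative, and \<open>inj\<close> says that \<open>?a\<close> and \<open>?b\<close>
      do not vanish together unless \<open>u\<close> is zero.\<close>
    let ?a = "A\<^sup>T *\<^sub>v u" and ?b = "A *\<^sub>v (H *\<^sub>v u)"
    note vc = mult_mat_vec_carrier[of _ n n] mc u(1)
    have "u \<bullet> (A *\<^sub>v (H *\<^sub>v ?a)) = ?a \<bullet> (H *\<^sub>v ?a)"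
      by (rule scalar_prod_transpose_mult[OF A]) (auto simp: vc)
    moreover have "u \<bullet> (H *\<^sub>v (A\<^sup>T *\<^sub>v (G *\<^sub>v ?b))) = ?b \<bullet> (G *\<^sub>v ?b)"
      using scalar_prod_transpose_mult[OF cH u(1), of "A\<^sup>T *\<^sub>v (G *\<^sub>v ?b)"]
        scalar_prod_transpose_mult[OF cT, of "H *\<^sub>v u" "G *\<^sub>v ?b"]
      by (simp add: vc H(2))
    moreover have "M *\<^sub>v u = A *\<^sub>v (H *\<^sub>v ?a) + H *\<^sub>v (A\<^sup>T *\<^sub>v (G *\<^sub>v ?b))"
      unfolding M_def by (subst add_mult_distrib_mat_vec[of _ n n]) (simp_all add: vc assoc_mult_mat_vec[of _ n n _ n])
    ultimately have eq: "u \<bullet> (M *\<^sub>v u) = ?a \<bullet> (H *\<^sub>v ?a) + ?b \<bullet> (G *\<^sub>v ?b)"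
      by (simp add: scalar_prod_add_distrib[of _ n] vc)
    have ca: "?a \<in> carrier_vec n" and cb: "?b \<in> carrier_vec n" by (simp_all add: vc)
    have "?a \<noteq> 0\<^sub>v n \<or> ?b \<noteq> 0\<^sub>v n" using inj u by blast
    then show "0 < u \<bullet> (M *\<^sub>v u)"
      unfolding eq
      using pos_def_nonneg[OF H(1) ca] pos_def_nonneg[OF G(1) cb] pos_def_eq_0[OF H(1) ca] pos_def_eq_0[OF G(1) cb]
      by linarith
  qed
  then have "0 < det (A * X + X * A)"
    unfolding fac using det_mult[OF M cG] pos_def_det_pos G(1) by simp
  with X show ?thesis using that by blast
qed

section \<open>Choosing the inner product by rank-one corrections\<close>

lemma one_col_mult_vec:
  fixes u :: "'a :: comm_semiring_1 vec"
  assumes "u \<in> carrier_vec n" "c \<in> carrier_vec 1"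
  shows "mat_of_cols n [u] *\<^sub>v c = (c $ 0) \<cdot>\<^sub>v u"
  by (rule eq_vecI) (use assms in \<open>auto simp: scalar_prod_def mat_of_cols_def ac_simps\<close>)

lemma smult_vec_eq_0:
  fixes u :: "'a :: idom vec"
  assumes "c \<cdot>\<^sub>v u = 0\<^sub>v n" "u \<in> carrier_vec n" "u \<noteq> 0\<^sub>v n"
  shows "c = 0"
proof -
  obtain i where "i < n" "u $ i \<noteq> 0" using assms(2,3) by (metis carrier_vecD eq_vecI index_zero_vec)
  moreover have "c * u $ i = 0"
    using assms \<open>i < n\<close> by (metis carrier_vecD index_smult_vec(1) index_zero_vec(1))
  ultimately show ?thesis by simp
qed

text \<open>Otherwise preimages of the unit vectors in \<open>ker B\<^sup>T\<close>, the vector \<open>u\<close> and the columns of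
  \<open>B\<close> would be \<open>2 r + 1 > n\<close> independent vectors.\<close>

lemma kernel_image_proper:
  fixes B K :: "real mat"
  assumes B: "B \<in> carrier_mat n r" and K: "K \<in> carrier_mat r n" and "n \<le> 2 * r"
    and inj: "\<And>x. x \<in> carrier_vec r \<Longrightarrow> B *\<^sub>v x = 0\<^sub>v n \<Longrightarrow> x = 0\<^sub>v r"
    and u: "u \<in> carrier_vec n" "u \<noteq> 0\<^sub>v n" "B\<^sup>T *\<^sub>v u = 0\<^sub>v r" "K *\<^sub>v u = 0\<^sub>v r"
  obtains e where "e \<in> carrier_vec r"
    "\<And>l. l \<in> carrier_vec n \<Longrightarrow> B\<^sup>T *\<^sub>v l = 0\<^sub>v r \<Longrightarrow> K *\<^sub>v l \<noteq> e"
proof (rule ccontr)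
  assume "\<not> thesis"
  then have "\<And>e. e \<in> carrier_vec r \<Longrightarrow>
      \<exists>l. l \<in> carrier_vec n \<and> B\<^sup>T *\<^sub>v l = 0\<^sub>v r \<and> K *\<^sub>v l = e"
    using that by metis
  then have "\<forall>i. \<exists>l. l \<in> carrier_vec n \<and> B\<^sup>T *\<^sub>v l = 0\<^sub>v r \<and> K *\<^sub>v l = unit_vec r i"
    by simp
  then obtain l where l: "\<And>i. l i \<in> carrier_vec n" "\<And>i. B\<^sup>T *\<^sub>v l i = 0\<^sub>v r"
      "\<And>i. K *\<^sub>v l i = unit_vec r i"
    by metis
  define \<Lambda> where "\<Lambda> = mat_of_cols n (map l [0..<r])"
  have \<Lambda>: "\<Lambda> \<in> carrier_mat n r" unfolding \<Lambda>_def by (simp add: carrier_matI)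
  have col\<Lambda>: "col \<Lambda> i = l i" if "i < r" for i
    using that l unfolding \<Lambda>_def by simp
  have BT: "B\<^sup>T \<in> carrier_mat r n" using B by simp
  have K\<Lambda>: "K * \<Lambda> = 1\<^sub>m r"
  proof (rule mat_col_eqI)
    fix i assume "i < dim_col (1\<^sub>m r :: real mat)"
    then have i: "i < r" by simp
    show "col (K * \<Lambda>) i = col (1\<^sub>m r) i"
      unfolding col_mult2[OF K \<Lambda> i] col\<Lambda>[OF i] l using i by simp
  qed (use K \<Lambda> in auto)
  have B\<Lambda>: "B\<^sup>T * \<Lambda> = 0\<^sub>m r r"
  proof (rule mat_col_eqI)
    fix i assume "i < dim_col (0\<^sub>m r r :: real mat)"
    then have i: "i < r" by simp
    show "col (B\<^sup>T * \<Lambda>) i = col (0\<^sub>m r r) i"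
      unfolding col_mult2[OF BT \<Lambda> i] col\<Lambda>[OF i] l using i by simp
  qed (use BT \<Lambda> in auto)
  \<comment> \<open>The \<open>r + 1\<close> columns of \<open>E\<close> together with the
    \<open>r\<close> columns of \<open>B\<close> exceed \<open>n\<close>, which yields a
    dependency.\<close>
  define E where "E = append_cols \<Lambda> (mat_of_cols n [u])"
  have cu: "mat_of_cols n [u] \<in> carrier_mat n 1" by (simp add: carrier_matI)
  have E: "E \<in> carrier_mat n (r + 1)" unfolding E_def using \<Lambda> cu by (rule append_cols_carrier)
  obtain z y where z: "z \<in> carrier_vec (r + 1)" and y: "y \<in> carrier_vec r"
    and zy: "E *\<^sub>v z + B *\<^sub>v y = 0\<^sub>v n" "z \<noteq> 0\<^sub>v (r + 1) \<or> y \<noteq> 0\<^sub>v r"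
    using append_cols_kernel[OF E B] \<open>n \<le> 2 * r\<close> by auto
  define x where "x = vec_first z r"
  define c where "c = vec_last z 1"
  have xc: "x \<in> carrier_vec r" "c \<in> carrier_vec 1" "z = x @\<^sub>v c"
    unfolding x_def c_def using z by auto
  have Ez: "E *\<^sub>v z = \<Lambda> *\<^sub>v x + c $ 0 \<cdot>\<^sub>v u"
    unfolding E_def xc(3) append_cols_mult_vec[OF \<Lambda> cu xc(1,2)] one_col_mult_vec[OF u(1) xc(2)] ..
  have cx: "\<Lambda> *\<^sub>v x \<in> carrier_vec n" and cBy: "B *\<^sub>v y \<in> carrier_vec n"
    using \<Lambda> xc B y by auto
  have zero_x: "0\<^sub>m r r *\<^sub>v x = 0\<^sub>v r"
    using xc(1) by (intro eq_vecI) auto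
  \<comment> \<open>\<open>B\<^sup>T\<close> kills every column of \<open>E\<close>. Applied to the
    dependency it leaves \<open>B\<^sup>T B y = 0\<close>, so \<open>B y\<close> has squared length
    0.\<close>
  have "B\<^sup>T *\<^sub>v (\<Lambda> *\<^sub>v x) = 0\<^sub>v r"
    using assoc_mult_mat_vec[OF BT \<Lambda> xc(1)] unfolding B\<Lambda> zero_x by simp
  then have "B\<^sup>T *\<^sub>v (E *\<^sub>v z) = 0\<^sub>v r"
    unfolding Ez
    using mult_add_distrib_mat_vec[OF BT cx, of "c $ 0 \<cdot>\<^sub>v u"] u
      mult_mat_vec[OF BT u(1), of "c $ 0"]
    by auto
  then have "B\<^sup>T *\<^sub>v (B *\<^sub>v y) = 0\<^sub>v r"
    using arg_cong[OF zy(1), of "\<lambda>v. B\<^sup>T *\<^sub>v v"]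
      mult_add_distrib_mat_vec[OF BT _ cBy, of "E *\<^sub>v z"] mult_mat_zero_vec[OF BT] E z BT cBy
    by auto
  then have "(B *\<^sub>v y) \<bullet> (B *\<^sub>v y) = 0"
    using scalar_prod_transpose_mult[OF B cBy y] y by simp
  then have By: "B *\<^sub>v y = 0\<^sub>v n" using scalar_prod_self_eq_0_iff[OF cBy] by simp
  then have y0: "y = 0\<^sub>v r" using inj y by simp
  have Ez0: "\<Lambda> *\<^sub>v x + c $ 0 \<cdot>\<^sub>v u = 0\<^sub>v n"
    using zy(1) cx u(1) unfolding By Ez by simp
  \<comment> \<open>Since \<open>K \<Lambda> = 1\<close> and \<open>K u = 0\<close>, applying
    \<open>K\<close> to what remains of the dependency isolates \<open>x\<close>.\<close>
  have "K *\<^sub>v (\<Lambda> *\<^sub>v x + c $ 0 \<cdot>\<^sub>v u) = x"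
    using mult_add_distrib_mat_vec[OF K cx, of "c $ 0 \<cdot>\<^sub>v u"] u
      mult_mat_vec[OF K u(1), of "c $ 0"] assoc_mult_mat_vec[OF K \<Lambda> xc(1)] K\<Lambda> xc(1)
    by auto
  then have x0: "x = 0\<^sub>v r" unfolding Ez0 using K by auto
  then have "c $ 0 \<cdot>\<^sub>v u = 0\<^sub>v n" using Ez0 mult_mat_zero_vec[OF \<Lambda>] u(1) by auto
  then have "c $ 0 = 0" using smult_vec_eq_0 u by blast
  then have "z = 0\<^sub>v (r + 1)"
    unfolding xc(3) x0 using xc(2) by (intro eq_vecI) auto
  then show False using zy(2) y0 by simp
qed

text \<open>\<open>H' = H + v v\<^sup>T\<close>: the added term contributes the square of
  \<open>v \<bullet> x\<close> to the quadratic form.\<close>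

lemma pos_def_add_rank_one:
  assumes "pos_def n H" "H\<^sup>T = H" "v \<in> carrier_vec n"
  obtains H' where "pos_def n H'" "H'\<^sup>T = H'"
    "\<And>x. x \<in> carrier_vec n \<Longrightarrow> H' *\<^sub>v x = H *\<^sub>v x + (v \<bullet> x) \<cdot>\<^sub>v v"
proof -
  have H: "H \<in> carrier_mat n n" using assms unfolding pos_def_def by blast
  define V where "V = mat n n (\<lambda>(i, j). v $ i * v $ j)"
  have V: "V \<in> carrier_mat n n" unfolding V_def by simp
  have "V *\<^sub>v x = (v \<bullet> x) \<cdot>\<^sub>v v" if "x \<in> carrier_vec n" for x
    by (rule eq_vecI)
      (use that assms(3) in \<open>auto simp: V_def scalar_prod_def sum_distrib_left sum_distrib_right ac_simps\<close>)
  then have mult: "(H + V) *\<^sub>v x = H *\<^sub>v x + (v \<bullet> x) \<cdot>\<^sub>v v" if "x \<in> carrier_vec n" for x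
    using add_mult_distrib_mat_vec[OF H V that] that by simp
  have "V\<^sup>T = V" unfolding V_def by (intro eq_matI) auto
  then have sym: "(H + V)\<^sup>T = H + V"
    using transpose_add[OF H V] assms(2) by simp
  have "pos_def n (H + V)"
    unfolding pos_def_def
  proof (intro conjI ballI impI)
    fix x :: "real vec" assume x: "x \<in> carrier_vec n" "x \<noteq> 0\<^sub>v n"
    have "x \<bullet> ((H + V) *\<^sub>v x) = x \<bullet> (H *\<^sub>v x) + (v \<bullet> x) * (v \<bullet> x)"
      unfolding mult[OF x(1)]
      using scalar_prod_add_distrib[OF x(1) mult_mat_vec_carrier[OF H x(1)], of "(v \<bullet> x) \<cdot>\<^sub>v v"]
        comm_scalar_prod[OF x(1) assms(3)] x(1) assms(3)
      by simp
    moreover have "0 < x \<bullet> (H *\<^sub>v x)" using assms(1) x unfolding pos_def_def by blast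
    ultimately show "0 < x \<bullet> ((H + V) *\<^sub>v x)" by (simp add: add_pos_nonneg)
  qed (use V in simp)
  with mult sym show ?thesis using that by blast
qed

text \<open>Each of the two conditions on \<open>v\<close> excludes a proper subspace, and two proper subspaces do
  not cover the whole space.\<close>

lemma separating_vector:
  fixes B C H S :: "real mat"
  assumes B: "B \<in> carrier_mat n r" and C: "C \<in> carrier_mat r n" and S: "S \<in> carrier_mat n r"
    and H: "H \<in> carrier_mat n n" and CS: "C * S = 1\<^sub>m r" and "n \<le> 2 * r"
    and inj: "\<And>x. x \<in> carrier_vec r \<Longrightarrow> B *\<^sub>v x = 0\<^sub>v n \<Longrightarrow> x = 0\<^sub>v r"
    and u: "u \<in> carrier_vec n" "u \<noteq> 0\<^sub>v n" "B\<^sup>T *\<^sub>v u = 0\<^sub>v r" "C *\<^sub>v (H *\<^sub>v u) = 0\<^sub>v r"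
  obtains v where "v \<in> carrier_vec n" "v \<bullet> u \<noteq> 0"
    "\<And>l. l \<in> carrier_vec n \<Longrightarrow> B\<^sup>T *\<^sub>v l = 0\<^sub>v r \<Longrightarrow> C *\<^sub>v (H *\<^sub>v l) \<noteq> C *\<^sub>v v"
proof -
  have K: "C * H \<in> carrier_mat r n" using C H by simp
  have BT: "B\<^sup>T \<in> carrier_mat r n" using B by simp
  have Kx: "(C * H) *\<^sub>v x = C *\<^sub>v (H *\<^sub>v x)" if "x \<in> carrier_vec n" for x
    using C H that by simp
  obtain e where e: "e \<in> carrier_vec r"
    "\<And>l. l \<in> carrier_vec n \<Longrightarrow> B\<^sup>T *\<^sub>v l = 0\<^sub>v r \<Longrightarrow> C *\<^sub>v (H *\<^sub>v l) \<noteq> e"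
    using kernel_image_proper[OF B K \<open>n \<le> 2 * r\<close> inj u(1-3)] u(1,4) Kx by metis
  \<comment> \<open>\<open>S\<close> is a right inverse of \<open>C\<close>, so this is a preimage
    of \<open>e\<close> under \<open>C\<close>.\<close>
  define v where "v = S *\<^sub>v e"
  have v: "v \<in> carrier_vec n" unfolding v_def using S e(1) by simp
  have Cv: "C *\<^sub>v v = e"
    unfolding v_def using assoc_mult_mat_vec[OF C S e(1)] CS e(1) by simp
  have uu: "u \<bullet> u \<noteq> 0" using scalar_prod_self_eq_0_iff u by blast
  \<comment> \<open>Either \<open>v\<close> or \<open>u\<close> meets both conditions, or each fails
    exactly one of them; then \<open>v + u\<close> meets both.\<close>
  consider "v \<bullet> u \<noteq> 0"
    | "\<And>l. l \<in> carrier_vec n \<Longrightarrow> B\<^sup>T *\<^sub>v l = 0\<^sub>v r \<Longrightarrow> C *\<^sub>v (H *\<^sub>v l) \<noteq> C *\<^sub>v u"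
    | l where "v \<bullet> u = 0" "l \<in> carrier_vec n" "B\<^sup>T *\<^sub>v l = 0\<^sub>v r" "C *\<^sub>v (H *\<^sub>v l) = C *\<^sub>v u"
    by blast
  then show ?thesis
  proof cases
    case 1
    then show ?thesis using that v e(2) Cv by blast
  next
    case 2
    then show ?thesis using that u(1) uu by blast
  next
    case 3
    \<comment> \<open>If \<open>m\<close> reached \<open>C (v + u)\<close>, then
      \<open>m - l\<close> would reach \<open>C v = e\<close>, which is excluded.\<close>
    have sep: "C *\<^sub>v (H *\<^sub>v m) \<noteq> C *\<^sub>v (v + u)" if m: "m \<in> carrier_vec n" "B\<^sup>T *\<^sub>v m = 0\<^sub>v r" for m
    proof
      assume "C *\<^sub>v (H *\<^sub>v m) = C *\<^sub>v (v + u)"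
      then have "(C * H) *\<^sub>v (m - l) = e + C *\<^sub>v u - C *\<^sub>v u"
        using mult_minus_distrib_mat_vec[OF K m(1) 3(2)] Kx m(1) 3
          mult_add_distrib_mat_vec[OF C v u(1)] Cv by simp
      also have "\<dots> = e" using e(1) C u(1) by (intro eq_vecI) auto
      finally have "C *\<^sub>v (H *\<^sub>v (m - l)) = e" using Kx m(1) 3(2) by simp
      moreover have "B\<^sup>T *\<^sub>v (m - l) = 0\<^sub>v r"
        using mult_minus_distrib_mat_vec[OF BT m(1) 3(2)] m(2) 3(3) by simp
      ultimately show False using e(2)[of "m - l"] m(1) 3(2) by simp
    qed
    have "(v + u) \<bullet> u \<noteq> 0"
      using add_scalar_prod_distrib[OF v u(1) u(1)] 3(1) uu by simp
    from add_carrier_vec[OF v u(1)] this sep show ?thesis by (rule that)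
  qed
qed

text \<open>Call \<open>u\<close> bad for \<open>H\<close> if \<open>B\<^sup>T u = 0\<close> and
  \<open>C (H u) = 0\<close>. Given a bad \<open>u\<close> other than 0, pass to
  \<open>H + v v\<^sup>T\<close> with \<open>v\<close> from \<open>separating_vector\<close>. As
  \<open>C v\<close> is not in the image of the kernel of \<open>B\<^sup>T\<close> under
  \<open>C H\<close>, a vector bad for the new matrix is orthogonal to \<open>v\<close> and was bad
  before; as \<open>v \<bullet> u\<close> is nonzero, \<open>u\<close> is no longer bad. So the bad
  subspace shrinks strictly.\<close>

lemma pos_def_trivial_kernel:
  fixes B C S :: "real mat"
  assumes B: "B \<in> carrier_mat n r" and C: "C \<in> carrier_mat r n" and S: "S \<in> carrier_mat n r"
    and CS: "C * S = 1\<^sub>m r" and "n \<le> 2 * r"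
    and inj: "\<And>x. x \<in> carrier_vec r \<Longrightarrow> B *\<^sub>v x = 0\<^sub>v n \<Longrightarrow> x = 0\<^sub>v r"
  obtains H where "pos_def n H" "H\<^sup>T = H"
    "\<And>u. u \<in> carrier_vec n \<Longrightarrow> B\<^sup>T *\<^sub>v u = 0\<^sub>v r \<Longrightarrow> C *\<^sub>v (H *\<^sub>v u) = 0\<^sub>v r \<Longrightarrow> u = 0\<^sub>v n"
proof (rule ccontr)
  assume "\<not> thesis"
  note thesis_rule = that
  define R where "R H u \<longleftrightarrow>
    u \<in> carrier_vec n \<and> B\<^sup>T *\<^sub>v u = 0\<^sub>v r \<and> C *\<^sub>v (H *\<^sub>v u) = 0\<^sub>v r" for H u
  have ex: "\<exists>u. R H u \<and> u \<noteq> 0\<^sub>v n" if "pos_def n H" "H\<^sup>T = H" for H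
    using \<open>\<not> thesis\<close> thesis_rule[of H] that unfolding R_def by blast
  have BT: "B\<^sup>T \<in> carrier_mat r n" using B by simp
  \<comment> \<open>The columns of \<open>U\<close> are independent modulo the bad subspace \<open>R H\<close>, so at most \<open>n\<close>
    rank-one corrections of \<open>H\<close> are possible.\<close>
  have "\<exists>H U. pos_def n H \<and> H\<^sup>T = H \<and> U \<in> carrier_mat n i \<and>
      (\<forall>x \<in> carrier_vec i. R H (U *\<^sub>v x) \<longrightarrow> x = 0\<^sub>v i)" for i
  proof (induction i)
    case 0
    show ?case
      by (rule exI[of _ "1\<^sub>m n"], rule exI[of _ "0\<^sub>m n 0"]) (auto simp: pos_def_one)
  next
    case (Suc i)
    then obtain H U where H: "pos_def n H" "H\<^sup>T = H" and U: "U \<in> carrier_mat n i"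
      and RU: "\<And>x. x \<in> carrier_vec i \<Longrightarrow> R H (U *\<^sub>v x) \<Longrightarrow> x = 0\<^sub>v i" by blast
    have cH: "H \<in> carrier_mat n n" using H unfolding pos_def_def by blast
    obtain u where "R H u" and u0: "u \<noteq> 0\<^sub>v n" using ex H by blast
    then have u: "u \<in> carrier_vec n" "B\<^sup>T *\<^sub>v u = 0\<^sub>v r" "C *\<^sub>v (H *\<^sub>v u) = 0\<^sub>v r"
      unfolding R_def by auto
    obtain v where v: "v \<in> carrier_vec n" "v \<bullet> u \<noteq> 0"
      "\<And>l. l \<in> carrier_vec n \<Longrightarrow> B\<^sup>T *\<^sub>v l = 0\<^sub>v r \<Longrightarrow> C *\<^sub>v (H *\<^sub>v l) \<noteq> C *\<^sub>v v"
      using separating_vector[OF B C S cH CS \<open>n \<le> 2 * r\<close> inj u(1) u0 u(2,3)] by blast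
    obtain H' where H': "pos_def n H'" "H'\<^sup>T = H'"
      "\<And>x. x \<in> carrier_vec n \<Longrightarrow> H' *\<^sub>v x = H *\<^sub>v x + (v \<bullet> x) \<cdot>\<^sub>v v"
      using pos_def_add_rank_one[OF H v(1)] by blast
    have RH': "R H w \<and> v \<bullet> w = 0" if "R H' w" for w
    proof -
      have w: "w \<in> carrier_vec n" "B\<^sup>T *\<^sub>v w = 0\<^sub>v r" "C *\<^sub>v (H' *\<^sub>v w) = 0\<^sub>v r"
        using that unfolding R_def by auto
      have cHw: "H *\<^sub>v w \<in> carrier_vec n" using cH w(1) by simp
      have sum0: "C *\<^sub>v (H *\<^sub>v w) + (v \<bullet> w) \<cdot>\<^sub>v (C *\<^sub>v v) = 0\<^sub>v r"
        using w(3) mult_add_distrib_mat_vec[OF C cHw, of "(v \<bullet> w) \<cdot>\<^sub>v v"]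
          mult_mat_vec[OF C v(1)] v(1) unfolding H'(3)[OF w(1)] by simp
      have vw: "v \<bullet> w = 0"
      proof (rule ccontr)
        assume nz: "v \<bullet> w \<noteq> 0"
        \<comment> \<open>By \<open>sum0\<close>, this factor rescales \<open>w\<close> to a vector
          that \<open>C H\<close> sends to \<open>C v\<close>, contrary to the choice of
          \<open>v\<close>.\<close>
        let ?c = "- inverse (v \<bullet> w)"
        have "C *\<^sub>v (H *\<^sub>v (?c \<cdot>\<^sub>v w)) = ?c \<cdot>\<^sub>v (C *\<^sub>v (H *\<^sub>v w))"
          using mult_mat_vec[OF cH w(1)] mult_mat_vec[OF C cHw] by simp
        also have "\<dots> = C *\<^sub>v v"
        proof (rule eq_vecI)
          fix k assume "k < dim_vec (C *\<^sub>v v)"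
          then have k: "k < r" using C by simp
          have "(C *\<^sub>v (H *\<^sub>v w)) $ k + (v \<bullet> w) * (C *\<^sub>v v) $ k = 0"
            using arg_cong[OF sum0, of "\<lambda>x. x $ k"] k C by simp
          then have "(C *\<^sub>v (H *\<^sub>v w)) $ k = - ((v \<bullet> w) * (C *\<^sub>v v) $ k)" by linarith
          then show "(?c \<cdot>\<^sub>v (C *\<^sub>v (H *\<^sub>v w))) $ k = (C *\<^sub>v v) $ k"
            using k C nz by (simp add: field_simps)
        qed (use C in simp)
        finally have "C *\<^sub>v (H *\<^sub>v (?c \<cdot>\<^sub>v w)) = C *\<^sub>v v" .
        moreover have "B\<^sup>T *\<^sub>v (?c \<cdot>\<^sub>v w) = 0\<^sub>v r"
          using mult_mat_vec[OF BT w(1), of ?c] w(2) by auto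
        moreover have "?c \<cdot>\<^sub>v w \<in> carrier_vec n" using w(1) by simp
        ultimately show False using v(3)[of "?c \<cdot>\<^sub>v w"] by simp
      qed
      have "C *\<^sub>v (H *\<^sub>v w) = 0\<^sub>v r"
        using sum0 mult_mat_vec_carrier[OF C cHw] mult_mat_vec_carrier[OF C v(1)]
        unfolding vw smult_vec_zero[OF mult_mat_vec_carrier[OF C v(1)]] by simp
      with w vw show ?thesis unfolding R_def by simp
    qed
    have cu: "mat_of_cols n [u] \<in> carrier_mat n 1" by (simp add: carrier_matI)
    define U' where "U' = append_cols U (mat_of_cols n [u])"
    have U': "U' \<in> carrier_mat n (Suc i)"
      using append_cols_carrier[OF U cu] unfolding U'_def by simp
    have "z = 0\<^sub>v (Suc i)" if z: "z \<in> carrier_vec (Suc i)" "R H' (U' *\<^sub>v z)" for z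
    proof -
      define x where "x = vec_first z i"
      define c where "c = vec_last z 1"
      have xc: "x \<in> carrier_vec i" "c \<in> carrier_vec 1" "z = x @\<^sub>v c"
        unfolding x_def c_def using z by auto
      have cUx: "U *\<^sub>v x \<in> carrier_vec n" using U xc by simp
      have cHUx: "H *\<^sub>v (U *\<^sub>v x) \<in> carrier_vec n" using cH cUx by simp
      have ccu: "c $ 0 \<cdot>\<^sub>v u \<in> carrier_vec n" using u by simp
      have U'z: "U' *\<^sub>v z = U *\<^sub>v x + c $ 0 \<cdot>\<^sub>v u"
        unfolding U'_def xc(3) append_cols_mult_vec[OF U cu xc(1,2)] one_col_mult_vec[OF u(1) xc(2)] ..
      \<comment> \<open>\<open>U' z\<close> and \<open>u\<close> are both bad for \<open>H\<close>,
        hence so is \<open>U x\<close>, and \<open>RU\<close> gives \<open>x = 0\<close>.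
        Orthogonality to \<open>v\<close> then removes the remaining multiple of
        \<open>u\<close>.\<close>
      have R: "R H (U' *\<^sub>v z)" "v \<bullet> (U' *\<^sub>v z) = 0" using RH' z(2) by auto
      have "B\<^sup>T *\<^sub>v (U *\<^sub>v x) = 0\<^sub>v r"
        using R(1) mult_add_distrib_mat_vec[OF BT cUx ccu] mult_mat_vec[OF BT u(1)] u(2) mult_mat_vec_carrier[OF BT cUx]
        unfolding R_def U'z by (auto simp: smult_zero_vec)
      moreover have "C *\<^sub>v (H *\<^sub>v (U *\<^sub>v x)) = 0\<^sub>v r"
        using R(1) mult_add_distrib_mat_vec[OF cH cUx ccu] mult_mat_vec[OF cH u(1)]
          mult_add_distrib_mat_vec[OF C cHUx, of "c $ 0 \<cdot>\<^sub>v (H *\<^sub>v u)"]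
          mult_mat_vec[OF C mult_mat_vec_carrier[OF cH u(1)]] u(3)
          mult_mat_vec_carrier[OF cH u(1)] mult_mat_vec_carrier[OF C cHUx]
        unfolding R_def U'z by (auto simp: smult_zero_vec)
      ultimately have x0: "x = 0\<^sub>v i" using RU xc(1) cUx unfolding R_def by blast
      have "U' *\<^sub>v z = c $ 0 \<cdot>\<^sub>v u" unfolding U'z x0 using mult_mat_zero_vec[OF U] u(1) by auto
      then have "c $ 0 = 0" using R(2) v(1,2) u(1) by simp
      then show ?thesis unfolding xc(3) x0 using xc(2) by (intro eq_vecI) auto
    qed
    with H' U' show ?case by blast
  qed
  \<comment> \<open>At \<open>i = n + 1\<close> the columns of \<open>U\<close> must be dependent,
    while 0 always lies in the bad subspace.\<close>
  then obtain H U where U: "U \<in> carrier_mat n (n + 1)" and H: "pos_def n H"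
    and RU: "\<And>x. x \<in> carrier_vec (n + 1) \<Longrightarrow> R H (U *\<^sub>v x) \<Longrightarrow> x = 0\<^sub>v (n + 1)" by blast
  obtain x where x: "x \<in> carrier_vec (n + 1)" "x \<noteq> 0\<^sub>v (n + 1)" "U *\<^sub>v x = 0\<^sub>v n"
    using wide_mat_kernel[OF U] by auto
  have "H \<in> carrier_mat n n" using H unfolding pos_def_def by blast
  then have "R H (0\<^sub>v n)"
    using mult_mat_zero_vec[OF BT] mult_mat_zero_vec[OF C] mult_mat_zero_vec[of H n n]
    unfolding R_def by auto
  then show False using RU x by metis
qed

section \<open>The two rank cases\<close>

text \<open>The conditions on \<open>B\<close> and \<open>C\<close> are carried back to
  \<open>A\<close>: \<open>B = A S\<close> turns \<open>A\<^sup>T u = 0\<close> into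
  \<open>B\<^sup>T u = 0\<close>, and injectivity of \<open>B\<close> turns
  \<open>A (H u) = 0\<close> into \<open>C (H u) = 0\<close>.\<close>

lemma det_positive_if_rank_ge:
  fixes A :: "real mat"
  assumes A: "A \<in> carrier_mat n n" and "n \<le> 2 * vec_space.rank n A"
  obtains X where "X \<in> carrier_mat n n" "0 < det (A * X + X * A)"
proof -
  interpret vec_space "TYPE(real)" n .
  obtain B C S where B: "B \<in> carrier_mat n (rank A)" and C: "C \<in> carrier_mat (rank A) n"
    and S: "S \<in> carrier_mat n (rank A)" and BC: "A = B * C" and BS: "B = A * S"
    and CS: "C * S = 1\<^sub>m (rank A)"
    and inj: "\<And>x. x \<in> carrier_vec (rank A) \<Longrightarrow> B *\<^sub>v x = 0\<^sub>v n \<Longrightarrow> x = 0\<^sub>v (rank A)"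
    using rank_factorization[OF A] by blast
  obtain H where H: "pos_def n H" "H\<^sup>T = H"
    "\<And>u. u \<in> carrier_vec n \<Longrightarrow> B\<^sup>T *\<^sub>v u = 0\<^sub>v (rank A) \<Longrightarrow>
      C *\<^sub>v (H *\<^sub>v u) = 0\<^sub>v (rank A) \<Longrightarrow> u = 0\<^sub>v n"
    using pos_def_trivial_kernel[OF B C S CS assms(2) inj] by blast
  have cH: "H \<in> carrier_mat n n" using H unfolding pos_def_def by blast
  have "u = 0\<^sub>v n" if u: "u \<in> carrier_vec n" "A\<^sup>T *\<^sub>v u = 0\<^sub>v n" "A *\<^sub>v (H *\<^sub>v u) = 0\<^sub>v n" for u
  proof (rule H(3)[OF u(1)])
    have "B\<^sup>T = S\<^sup>T * A\<^sup>T" using transpose_mult[OF A S] BS by simp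
    then show "B\<^sup>T *\<^sub>v u = 0\<^sub>v (rank A)"
      using assoc_mult_mat_vec[of "S\<^sup>T" "rank A" n "A\<^sup>T" n u] u S A by auto
    have cHu: "H *\<^sub>v u \<in> carrier_vec n" using cH u(1) by simp
    have "B *\<^sub>v (C *\<^sub>v (H *\<^sub>v u)) = 0\<^sub>v n"
      using assoc_mult_mat_vec[OF B C cHu] u(3) unfolding BC[symmetric] by simp
    then show "C *\<^sub>v (H *\<^sub>v u) = 0\<^sub>v (rank A)" using inj C cHu by simp
  qed
  then show ?thesis using pos_def_conj_sum[OF H(1,2) A] that by blast
qed

text \<open>\<open>C v = 0\<close> and \<open>C (X v) = 0\<close> amount to
  \<open>2 * rank A\<close> linear equations in \<open>n\<close> unknowns. This is pure linear
  algebra, hence stated over any field.\<close>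

lemma det_zero_if_rank_lt:
  fixes A :: "'a :: field mat"
  assumes A: "A \<in> carrier_mat n n" and "2 * vec_space.rank n A < n" and X: "X \<in> carrier_mat n n"
  shows "det (A * X + X * A) = 0"
proof -
  interpret vec_space "TYPE('a)" n .
  obtain B C where B: "B \<in> carrier_mat n (rank A)" and C: "C \<in> carrier_mat (rank A) n"
    and BC: "A = B * C"
    by (rule rank_factorization[OF A]) (rule that)
  have CX: "C * X \<in> carrier_mat (rank A) n" using C X by simp
  obtain v where v: "v \<in> carrier_vec n" "v \<noteq> 0\<^sub>v n"
    and "(C @\<^sub>r (C * X)) *\<^sub>v v = 0\<^sub>v (rank A + rank A)"
    using wide_mat_kernel[OF carrier_append_rows[OF C CX]] assms(2) by auto
  moreover have "0\<^sub>v (rank A + rank A) = (0\<^sub>v (rank A) @\<^sub>v 0\<^sub>v (rank A) :: 'a vec)"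
    by (intro eq_vecI) auto
  ultimately have "C *\<^sub>v v @\<^sub>v (C * X) *\<^sub>v v = 0\<^sub>v (rank A) @\<^sub>v 0\<^sub>v (rank A)"
    using mat_mult_append[OF C CX v(1)] by simp
  then have Cv: "C *\<^sub>v v = 0\<^sub>v (rank A)" and CXv: "C *\<^sub>v (X *\<^sub>v v) = 0\<^sub>v (rank A)"
    using C X v(1) append_vec_eq[of "C *\<^sub>v v" "rank A" "0\<^sub>v (rank A)"] by auto
  have Ax: "A *\<^sub>v x = 0\<^sub>v n" if "x \<in> carrier_vec n" "C *\<^sub>v x = 0\<^sub>v (rank A)" for x
    using assoc_mult_mat_vec[OF B C that(1)] that(2) mult_mat_zero_vec[OF B] unfolding BC[symmetric] by auto
  have "(A * X + X * A) *\<^sub>v v = A *\<^sub>v (X *\<^sub>v v) + X *\<^sub>v (A *\<^sub>v v)"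
    using A X v(1) by (subst add_mult_distrib_mat_vec[of _ n n]) auto
  also have "\<dots> = 0\<^sub>v n" using Ax Cv CXv mult_mat_zero_vec[OF X] X v(1) by auto
  finally show ?thesis
    using det_0_iff_vec_prod_zero[of "A * X + X * A" n] A X v by auto
qed

section \<open>Descent from real matrices to the subfield\<close>

text \<open>Rounding down after scaling by \<open>Suc m\<close> errs by at most
  \<open>1 / Suc m\<close>; the successor keeps the denominator nonzero.\<close>

lemma rat_tendsto_real:
  fixes x :: real
  shows "(\<lambda>m. of_int \<lfloor>real (Suc m) * x\<rfloor> / real (Suc m)) \<longlonglongrightarrow> x"
proof (rule tendsto_sandwich)
  show "\<forall>\<^sub>F m in sequentially. x - inverse (real (Suc m)) \<le> of_int \<lfloor>real (Suc m) * x\<rfloor> / real (Suc m)"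
  proof (rule always_eventually, rule allI)
    fix m
    have "real (Suc m) * x - 1 \<le> of_int \<lfloor>real (Suc m) * x\<rfloor>" by linarith
    then have "(real (Suc m) * x - 1) / real (Suc m) \<le> of_int \<lfloor>real (Suc m) * x\<rfloor> / real (Suc m)"
      by (intro divide_right_mono) auto
    then show "x - inverse (real (Suc m)) \<le> of_int \<lfloor>real (Suc m) * x\<rfloor> / real (Suc m)"
      by (simp add: diff_divide_distrib inverse_eq_divide del: of_nat_Suc)
  qed
  show "\<forall>\<^sub>F m in sequentially. of_int \<lfloor>real (Suc m) * x\<rfloor> / real (Suc m) \<le> x"
  proof (rule always_eventually, rule allI)
    fix m
    have "of_int \<lfloor>real (Suc m) * x\<rfloor> \<le> real (Suc m) * x" by linarith
    then show "of_int \<lfloor>real (Suc m) * x\<rfloor> / real (Suc m) \<le> x"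
      by (simp add: field_simps del: of_nat_Suc)
  qed
  show "(\<lambda>m. x - inverse (real (Suc m))) \<longlonglongrightarrow> x"
    using tendsto_diff[OF tendsto_const LIMSEQ_inverse_real_of_nat, of x] by simp
qed simp

text \<open>A subfield contains the prime field, so the approximants above lie in \<open>K\<close>.
  A zero denominator is harmless, since then the quotient is 0.\<close>

lemma subfield_divide_int:
  fixes K :: "'a :: field set"
  assumes "subfield K class_ring"
  shows "of_int a / of_nat m \<in> K"
proof -
  have one: "1 \<in> K" and neg: "\<And>x. x \<in> K \<Longrightarrow> - x \<in> K" and inv: "\<And>x. x \<in> K \<Longrightarrow> inverse x \<in> K"
    and add: "\<And>x y. x \<in> K \<Longrightarrow> y \<in> K \<Longrightarrow> x + y \<in> K"
    and mult: "\<And>x y. x \<in> K \<Longrightarrow> y \<in> K \<Longrightarrow> x * y \<in> K"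
    using assms unfolding subfield_class_ring_iff by auto
  have zero: "0 \<in> K" using add[OF one neg[OF one]] by simp
  have nat: "of_nat k \<in> K" for k
    by (induction k) (auto intro: zero one add)
  have "of_int a \<in> K"
    by (cases a) (use neg nat in \<open>auto simp del: of_nat_Suc\<close>)
  then show ?thesis unfolding divide_inverse using inv mult nat by blast
qed

text \<open>Positivity of the determinant is an open condition on \<open>X\<close>, so it survives
  replacing the entries by close enough rationals while \<open>A\<close> stays fixed.\<close>

lemma det_positive_over_subfield:
  fixes A X :: "real mat"
  assumes K: "subfield K class_ring" and A: "A \<in> carrier_mat n n" and X: "X \<in> carrier_mat n n"
    and pos: "0 < det (A * X + X * A)"
  obtains Y where "Y \<in> mats_over K n" "0 < det (A * Y + Y * A)"
proof -
  define Y where "Y m = mat n n (\<lambda>ij. of_int \<lfloor>real (Suc m) * X $$ ij\<rfloor> / real (Suc m))" for m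
  have Y: "Y m \<in> carrier_mat n n" for m unfolding Y_def by simp
  have lim: "(\<lambda>m. Y m $$ (i, j)) \<longlonglongrightarrow> X $$ (i, j)" if "i < n" "j < n" for i j
    using rat_tendsto_real that unfolding Y_def by simp
  have "(\<lambda>m. det (A * Y m + Y m * A)) \<longlonglongrightarrow> det (A * X + X * A)"
  proof (rule tendsto_det[of _ n])
    fix i j assume ij: "i < n" "j < n"
    have "(A * Z + Z * A) $$ (i, j) = (\<Sum>k<n. A $$ (i, k) * Z $$ (k, j)) + (\<Sum>k<n. Z $$ (i, k) * A $$ (k, j))"
      if "Z \<in> carrier_mat n n" for Z
      using that A ij by (simp add: scalar_prod_def atLeast0LessThan)
    then show "(\<lambda>m. (A * Y m + Y m * A) $$ (i, j)) \<longlonglongrightarrow> (A * X + X * A) $$ (i, j)"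
      using X Y ij by (auto intro!: tendsto_intros lim)
  qed (use A X Y in \<open>auto intro!: add_carrier_mat mult_carrier_mat[of _ n n]\<close>)
  then have "\<forall>\<^sub>F m in sequentially. 0 < det (A * Y m + Y m * A)"
    using pos by (rule order_tendstoD)
  then obtain m where "0 < det (A * Y m + Y m * A)"
    using eventually_happens trivial_limit_sequentially by blast
  moreover have "Y m \<in> mats_over K n"
    unfolding mats_over_iff using Y subfield_divide_int[OF K] by (simp add: Y_def del: of_nat_Suc)
  ultimately show ?thesis using that by blast
qed

theorem corollary2:
  fixes K :: "real set" and n :: nat and A :: "real mat"
  assumes "subfield K class_ring"
    and "n \<ge> 2"
    and "A \<in> mats_over K n"
  shows "(\<forall>X \<in> mats_over K n. det (A * X + X * A) \<le> 0)
    \<longleftrightarrow> real (vec_space.rank n A) < real n / 2"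
proof
  have A: "A \<in> carrier_mat n n" using assms(3) unfolding mats_over_iff by blast
  {
    assume le: "\<forall>X \<in> mats_over K n. det (A * X + X * A) \<le> 0"
    show "real (vec_space.rank n A) < real n / 2"
    proof (rule ccontr)
      assume "\<not> ?thesis"
      then have "n \<le> 2 * vec_space.rank n A" by linarith
      then obtain X where "X \<in> carrier_mat n n" "0 < det (A * X + X * A)"
        using det_positive_if_rank_ge[OF A] by blast
      then obtain Y where "Y \<in> mats_over K n" "0 < det (A * Y + Y * A)"
        by (rule det_positive_over_subfield[OF assms(1) A])
      then show False using le by force
    qed
  next
    assume "real (vec_space.rank n A) < real n / 2"
    then have "2 * vec_space.rank n A < n" by linarith
    then show "\<forall>X \<in> mats_over K n. det (A * X + X * A) \<le> 0"
      using det_zero_if_rank_lt[OF A] by (simp add: mats_over_iff)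
  }
qed

end
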